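(* Let $v\in\mathbb{R}$, $\lambda>0$, $1<\omega\leq2$. If the diffusive sub-characteristic stability condition $|v|<\lambda$ is satisfied, then the matrix $$P=\begin{pmatrix}1&0\\0&\frac{1}{\lambda^2-v^2}\end{pmatrix}$$ symmetrizes the equivalent system of the D1Q2 model, i.e. $P$ is symmetric positive definite and $PA$ is symmetric, where $A$ is the first-order matrix of that system given in the context. Consequently, the equivalent system of the D1Q2 model is hyperbolic if $|v|<\lambda$.
   Context: The equivalent system of the D1Q2 vectorial lattice-Boltzmann model (kinetic velocities $\pm\lambda$, relaxation parameter $\omega$, time step $\Delta t$) for the scalar transport equation $\partial_t w+v\,\partial_x w=0$, in the unknowns $(w,y)$ where $y$ is the flux error, is $$\partial_t\begin{pmatrix}w\\ y\end{pmatrix}-\frac{\omega(\omega-2)(\omega^2-2\omega+2)}{2\Delta t(\omega-1)^2}\begin{pmatrix}0\\ y\end{pmatrix}+A\,\partial_x\begin{pmatrix}w\\ y\end{pmatrix}=O(\Delta t),\qquad A=\begin{pmatrix}v&\gamma_1\\(\lambda^2-v^2)\gamma_1&-v\gamma_2\end{pmatrix},$$ with $$\gamma_1=\frac{(\omega-2)^2(\omega^2-2\omega+2)}{8(\omega-1)^2},\qquad \gamma_2=\frac{\omega^4-4\omega^3+6\omega^2-4\omega+2}{2(\omega-1)^2}.$$ Definition: an equivalent system with first-order matrices $A^1,\dots,A^d$ (here $d=1$, $A^1=A$) is called hyperbolic if and only if there exists a symmetric positive definite matrix $P^0$ such that $P^0A^i$ is symmetric for all $1\leq i\leq d$. Such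 a matrix is said to symmetrize the system. *)

theory Defs
  imports "HOL-Analysis.Analysis"
begin

text \<open>
  A first-order linear system on \<open>d\<close>-dimensional space, with \<open>n\<close> unknowns \<open>U\<close>, of the form
  \<open>\<partial>\<^sub>t U + B U + (\<Sum>i. A\<^sub>i \<partial>\<^sub>i U) = O(\<Delta>t)\<close>, is represented by the coefficients \<open>B\<close> (order zero) and
  \<open>A\<^sub>i\<close> (order one); the index types \<open>'n\<close> and \<open>'d\<close> carry \<open>n\<close> and \<open>d\<close>.
  The unspecified remainder \<open>O(\<Delta>t)\<close> is not part of the data, since hyperbolicity does not involve it.
\<close>

record ('n, 'd) linear_system =
  zeroth_order :: "real ^ 'n ^ 'n"
  first_order :: "'d \<Rightarrow> real ^ 'n ^ 'n"

definition symmetric_matrix :: "real ^ 'n ^ 'n \<Rightarrow> bool" where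
  "symmetric_matrix M \<longleftrightarrow> transpose M = M"

definition symmetric_positive_definite :: "real ^ 'n ^ 'n \<Rightarrow> bool" where
  "symmetric_positive_definite M \<longleftrightarrow>
     symmetric_matrix M \<and> (\<forall>x. x \<noteq> 0 \<longrightarrow> 0 < x \<bullet> (M *v x))"

definition symmetrizes :: "real ^ 'n ^ 'n \<Rightarrow> ('n, 'd) linear_system \<Rightarrow> bool" where
  "symmetrizes P S \<longleftrightarrow>
     symmetric_positive_definite P \<and> (\<forall>i. symmetric_matrix (P ** first_order S i))"

definition hyperbolic :: "('n::finite, 'd) linear_system \<Rightarrow> bool" where
  "hyperbolic S \<longleftrightarrow> (\<exists>P. symmetrizes P S)"

definition gamma1 :: "real \<Rightarrow> real" where
  "gamma1 \<omega> = (\<omega> - 2)^2 * (\<omega>^2 - 2 * \<omega> + 2) / (8 * (\<omega> - 1)^2)"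

definition gamma2 :: "real \<Rightarrow> real" where
  "gamma2 \<omega> = (\<omega>^4 - 4 * \<omega>^3 + 6 * \<omega>^2 - 4 * \<omega> + 2) / (2 * (\<omega> - 1)^2)"

text \<open>The unknowns of the D1Q2 system are \<open>(w, y)\<close>, with \<open>y\<close> the flux error.\<close>

definition d1q2_zeroth_order :: "real \<Rightarrow> real \<Rightarrow> real ^ 2 ^ 2" where
  "d1q2_zeroth_order \<omega> \<Delta>t =
     vector [vector [0, 0],
             vector [0, - (\<omega> * (\<omega> - 2) * (\<omega>^2 - 2 * \<omega> + 2) / (2 * \<Delta>t * (\<omega> - 1)^2))]]"

definition d1q2_first_order :: "real \<Rightarrow> real \<Rightarrow> real \<Rightarrow> real ^ 2 ^ 2" where
  "d1q2_first_order v lam \<omega> =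
     vector [vector [v, gamma1 \<omega>],
             vector [(lam^2 - v^2) * gamma1 \<omega>, - v * gamma2 \<omega>]]"

definition d1q2_equivalent_system ::
    "real \<Rightarrow> real \<Rightarrow> real \<Rightarrow> real \<Rightarrow> (2, 1) linear_system" where
  "d1q2_equivalent_system v lam \<omega> \<Delta>t =
     \<lparr> zeroth_order = d1q2_zeroth_order \<omega> \<Delta>t,
       first_order = (\<lambda>_. d1q2_first_order v lam \<omega>) \<rparr>"

end

theory Submission
  imports Defs
begin

text \<open>The off-diagonal entries of the first-order matrix are \<open>gamma1 \<omega>\<close>
  and the same number times \<open>lam^2 - v^2\<close>. Left multiplication by a diagonal matrix
  scales rows (\<open>diag_2_matrix_mult\<close>), so dividing the second row by that factor makes
  the two entries equal. The condition \<open>\<bar>v\<bar> < lam\<close> makes the factor positive,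
  hence the diagonal symmetrizer is positive definite
  (\<open>symmetric_positive_definite_diag_2\<close>).\<close>

lemma symmetric_matrix_2:
  "symmetric_matrix (vector [vector [a, b], vector [c, d]] :: real ^ 2 ^ 2) \<longleftrightarrow> b = c"
  by (auto simp: symmetric_matrix_def transpose_def vec_eq_iff forall_2)

lemma symmetric_positive_definite_diag_2:
  assumes "0 < a" and "0 < d"
  shows "symmetric_positive_definite (vector [vector [a, 0], vector [0, d]] :: real ^ 2 ^ 2)"
proof -
  have "0 < x \<bullet> ((vector [vector [a, 0], vector [0, d]] :: real ^ 2 ^ 2) *v x)"
    if "x \<noteq> 0" for x :: "real ^ 2"
  proof -
    have "x \<bullet> ((vector [vector [a, 0], vector [0, d]] :: real ^ 2 ^ 2) *v x)
        = a * (x $ 1)\<^sup>2 + d * (x $ 2)\<^sup>2"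
      by (simp add: inner_vec_def matrix_vector_mult_def sum_2 power2_eq_square)
    moreover have "x $ 1 \<noteq> 0 \<or> x $ 2 \<noteq> 0"
      using that by (simp add: vec_eq_iff forall_2)
    \<comment> \<open>Both terms are nonnegative, and the one with a nonzero coordinate is strictly
      positive.\<close>
    then have "0 < a * (x $ 1)\<^sup>2 + d * (x $ 2)\<^sup>2"
      using assms by (auto intro: add_pos_nonneg add_nonneg_pos)
    ultimately show ?thesis by simp
  qed
  then show ?thesis
    by (simp add: symmetric_positive_definite_def symmetric_matrix_2)
qed

lemma diag_2_matrix_mult:
  "(vector [vector [p, 0], vector [0, q]] :: real ^ 2 ^ 2)
     ** (vector [vector [a, b], vector [c, d]] :: real ^ 2 ^ 2)
   = vector [vector [p * a, p * b], vector [q * c, q * d]]"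
  by (simp add: matrix_matrix_mult_def vec_eq_iff forall_2 sum_2)

theorem theorem15:
  fixes v lam \<omega> \<Delta>t :: real
  assumes "lam > 0" and "1 < \<omega>" and "\<omega> \<le> 2" and "\<Delta>t > 0"
    and "\<bar>v\<bar> < lam"
  shows "symmetrizes (vector [vector [1, 0], vector [0, 1 / (lam^2 - v^2)]])
           (d1q2_equivalent_system v lam \<omega> \<Delta>t)
       \<and> hyperbolic (d1q2_equivalent_system v lam \<omega> \<Delta>t)"
proof -
  \<comment> \<open>Squaring is monotone only on nonnegative reals, so it is applied to
    \<open>\<bar>v\<bar>\<close>, as \<open>v\<close> may be negative.\<close>
  have "v\<^sup>2 < lam\<^sup>2"
    using assms(5) power_strict_mono[of "\<bar>v\<bar>" lam 2] by simp
  \<comment> \<open>The strict inequality serves twice: the entry \<open>1 / (lam^2 - v^2)\<close>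
    is positive, and the nonzero factor cancels in the lower-left entry of the product, leaving
    \<open>gamma1 \<omega>\<close>.\<close>
  then have "symmetrizes (vector [vector [1, 0], vector [0, 1 / (lam^2 - v^2)]])
      (d1q2_equivalent_system v lam \<omega> \<Delta>t)"
    by (simp add: symmetrizes_def d1q2_equivalent_system_def d1q2_first_order_def
        symmetric_positive_definite_diag_2 diag_2_matrix_mult symmetric_matrix_2)
  \<comment> \<open>The explicit symmetrizer is the witness for hyperbolicity.\<close>
  then show ?thesis
    unfolding hyperbolic_def by blast
qed

end
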